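(* Let $\Phi_1,\Phi_4:[0,\infty)\to\mathbb R$ be arbitrary nowhere-vanishing functions, let $\xi,\beta,\gamma,\theta,v:[0,\infty)\to\mathbb R$ be arbitrary functions, and let $a,b\in\mathbb R$ and $\alpha_6>0$. For $0\le s\le t$ put $$a_i^{[s,t]}=\frac{\Phi_i(t)}{\Phi_i(s)}\ (i=1,4),\qquad a_6^{[s,t]}=\begin{cases}1,& s\le t<\alpha_6,\\ 0,& t\ge\alpha_6,\end{cases}\qquad a_2^{[s,t]}=\frac{\Phi_4(t)}{\Phi_1(s)}\big(\xi(t)-\xi(s)\big),$$ $$a_5^{[s,t]}=\frac1{\Phi_4(s)}\begin{cases}\beta(t)-\beta(s),& s\le t<\alpha_6,\\ \gamma(t),& t\ge\alpha_6,\end{cases}$$ $$a_3^{[s,t]}=\frac1{\Phi_1(s)}\begin{cases} a\beta(s)\xi(s)-\beta(t)\xi(s)+(1-a)\beta(t)\xi(t)+\theta(t)-\theta(s),& s\le t<\alpha_6,\\ \gamma(t)\big(v(t)+b\,\xi(t)-\xi(s)\big),& t\ge\alpha_6.\end{cases}$$ Then the family of matrices $$\mathcal M^{[s,t]}=\begin{pmatrix} a_1^{[s,t]}&a_2^{[s,t]}&a_3^{[s,t]}\\ 0&a_4^{[s,t]}&a_5^{[s,t]}\\ 0&0&a_6^{[s,t]}\end{pmatrix}$$ generates a chain of evolution algebras, i.e. it is the family of matrices of structural constants of a chain of three-dimensional evolution algebras.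
   Context: A family $\{E^{[s,t]}: s,t\in\mathbb R,\ 0\le s\le t\}$ of $n$-dimensional evolution algebras over $\mathbb R$ consists of algebras with common basis $e_1,\dots,e_n$ and multiplication $e_ie_i=\sum_{j=1}^n a_{ij}^{[s,t]}e_j$, $e_ie_j=0$ for $i\ne j$; $\mathcal M^{[s,t]}=(a_{ij}^{[s,t]})$ is its matrix of structural constants. The family is a chain of evolution algebras if $\mathcal M^{[s,t]}=\mathcal M^{[s,\tau]}\mathcal M^{[\tau,t]}$ for all $0\le s<\tau<t$. *)

theory Defs
  imports "HOL-Analysis.Analysis"
begin

definition evolution_algebra ::
    "('n::finite \<Rightarrow> 'v::real_vector) \<Rightarrow> ('v \<Rightarrow> 'v \<Rightarrow> 'v) \<Rightarrow> bool" where
  "evolution_algebra e m \<longleftrightarrow>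
     inj e \<and> independent (range e) \<and> span (range e) = UNIV \<and> bilinear m \<and>
     (\<forall>i j. i \<noteq> j \<longrightarrow> m (e i) (e j) = 0)"

definition structural_matrix ::
    "('n::finite \<Rightarrow> 'v::real_vector) \<Rightarrow> ('v \<Rightarrow> 'v \<Rightarrow> 'v) \<Rightarrow> real ^ 'n ^ 'n" where
  "structural_matrix e m = (\<chi> i j. representation (range e) (m (e i) (e i)) (e j))"

lemma structural_matrix_eq_iff:
  assumes "evolution_algebra e m"
  shows "structural_matrix e m = A \<longleftrightarrow> (\<forall>i. m (e i) (e i) = (\<Sum>j\<in>UNIV. A $ i $ j *\<^sub>R e j))"
proof -
  have inj: "inj e" and ind: "independent (range e)" and sp: "span (range e) = UNIV"
    using assms by (auto simp: evolution_algebra_def)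
  have expand: "x = (\<Sum>j\<in>UNIV. representation (range e) x (e j) *\<^sub>R e j)" for x
    using real_vector.sum_representation_eq[OF ind, of x "range e"] sp inj
    by (simp add: sum.reindex)
  have rep: "representation (range e) (\<Sum>j\<in>UNIV. c j *\<^sub>R e j) (e k) = c k" for c k
    using inj
    by (simp add: real_vector.representation_sum[OF ind] real_vector.representation_scale[OF ind]
        real_vector.representation_basis[OF ind] real_vector.span_base real_vector.span_scale
        inj_eq if_distrib cong: if_cong)
  show ?thesis
  proof
    assume "structural_matrix e m = A"
    then show "\<forall>i. m (e i) (e i) = (\<Sum>j\<in>UNIV. A $ i $ j *\<^sub>R e j)"
      using expand by (auto simp: structural_matrix_def)
  next
    assume "\<forall>i. m (e i) (e i) = (\<Sum>j\<in>UNIV. A $ i $ j *\<^sub>R e j)"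
    then show "structural_matrix e m = A"
      by (simp add: structural_matrix_def vec_eq_iff rep)
  qed
qed

text \<open>A two-parameter family is a total function of \<open>s\<close> and \<open>t\<close>, of which only the values
  for \<open>0 \<le> s \<le> t\<close> matter. The basis \<open>e\<close> does not depend on \<open>s\<close> and \<open>t\<close>.\<close>

definition chain_of_evolution_algebras ::
    "('n::finite \<Rightarrow> 'v::real_vector) \<Rightarrow> (real \<Rightarrow> real \<Rightarrow> 'v \<Rightarrow> 'v \<Rightarrow> 'v) \<Rightarrow> bool" where
  "chain_of_evolution_algebras e m \<longleftrightarrow>
     (\<forall>s t. 0 \<le> s \<and> s \<le> t \<longrightarrow> evolution_algebra e (m s t)) \<and>
     (\<forall>s \<tau> t. 0 \<le> s \<and> s < \<tau> \<and> \<tau> < t \<longrightarrow>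
        structural_matrix e (m s t) = structural_matrix e (m s \<tau>) ** structural_matrix e (m \<tau> t))"

text \<open>Every \<open>n\<close>-dimensional real vector space is isomorphic to \<open>real ^ 'n\<close> with \<open>CARD('n) = n\<close>,
  so the underlying space can be fixed.\<close>

definition generates_chain :: "(real \<Rightarrow> real \<Rightarrow> real ^ 'n ^ 'n) \<Rightarrow> bool" where
  "generates_chain M \<longleftrightarrow>
     (\<exists>(e :: 'n \<Rightarrow> real ^ 'n) m. chain_of_evolution_algebras e m \<and>
        (\<forall>s t. 0 \<le> s \<and> s \<le> t \<longrightarrow> structural_matrix e (m s t) = M s t))"

end

theory Submission
  imports Defs
begin

text \<open>Any real square matrix \<open>A\<close> is realised on the standard basis by the product
  whose value at \<open>x\<close>, \<open>y\<close> is the combination of the rows of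
  \<open>A\<close> with coefficients \<open>x $ i * y $ i\<close>. So a family of matrices generates
  a chain as soon as it satisfies the Chapman-Kolmogorov equation (\<open>generates_chainI\<close>).
  For upper triangular 3 by 3 matrices this is six scalar equations
  (\<open>upper_triangular_3_mult\<close>): the diagonal entries are multiplicative in time, and the
  others follow by telescoping once the factors \<Phi>1 and \<Phi>4 at the intermediate time
  cancel.\<close>

definition evolution_product :: "real ^ 'n ^ 'n \<Rightarrow> real ^ 'n \<Rightarrow> real ^ 'n \<Rightarrow> real ^ 'n" where
  "evolution_product A x y = (\<Sum>i\<in>UNIV. (x $ i * y $ i) *\<^sub>R (A $ i))"

lemma evolution_product_axis:
  "evolution_product A (axis i 1) (axis j 1) = (if i = j then A $ i else 0)"
proof -
  \<comment> \<open>The outer test against the summation index \<open>k\<close> lets the sum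
    collapse to a single term.\<close>
  have "(axis i 1 $ k * axis j 1 $ k) *\<^sub>R (A $ k) = (if k = i then if i = j then A $ i else 0 else 0)"
    for k
    by (simp add: axis_def)
  then show ?thesis
    by (simp add: evolution_product_def)
qed

lemma bilinear_evolution_product: "bilinear (evolution_product A)"
  by (auto simp: bilinear_def evolution_product_def scaleR_sum_right algebra_simps
      sum.distrib intro!: linearI)

text \<open>Makes the independence and spanning facts about \<open>Basis\<close> available for the
  indexed family \<open>axis i 1\<close>.\<close>

lemma range_axis_eq_Basis: "range (\<lambda>i. axis i 1) = (Basis :: (real ^ 'n) set)"
  by (auto simp: Basis_vec_def)

lemma evolution_algebra_evolution_product:
  "evolution_algebra (\<lambda>i. axis i 1) (evolution_product A)"
  unfolding evolution_algebra_def range_axis_eq_Basis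
  by (auto simp: inj_def axis_eq_axis independent_Basis span_Basis
      bilinear_evolution_product evolution_product_axis)

lemma structural_matrix_evolution_product:
  "structural_matrix (\<lambda>i. axis i 1) (evolution_product A) = A"
  unfolding structural_matrix_eq_iff[OF evolution_algebra_evolution_product]
  by (simp add: evolution_product_axis basis_expansion flip: scalar_mult_eq_scaleR)

lemma generates_chainI:
  assumes "\<And>s \<tau> t. 0 \<le> s \<Longrightarrow> s < \<tau> \<Longrightarrow> \<tau> < t \<Longrightarrow> M s t = M s \<tau> ** M \<tau> t"
  shows "generates_chain M"
  unfolding generates_chain_def chain_of_evolution_algebras_def
  by (intro exI[of _ "\<lambda>i. axis i 1"] exI[of _ "\<lambda>s t. evolution_product (M s t)"])
    (simp add: evolution_algebra_evolution_product structural_matrix_evolution_product assms)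

lemma upper_triangular_3_mult:
  fixes a1 :: "'a::semiring_1"
  shows "(vector [vector [a1, a2, a3], vector [0, a4, a5], vector [0, 0, a6]] :: 'a ^ 3 ^ 3) **
      (vector [vector [b1, b2, b3], vector [0, b4, b5], vector [0, 0, b6]] :: 'a ^ 3 ^ 3) =
    (vector [vector [a1 * b1, a1 * b2 + a2 * b4, a1 * b3 + a2 * b5 + a3 * b6],
      vector [0, a4 * b4, a4 * b5 + a5 * b6],
      vector [0, 0, a6 * b6]] :: 'a ^ 3 ^ 3)"
  by (simp add: vec_eq_iff forall_3 matrix_matrix_mult_def sum_3)

theorem proposition2:
  fixes \<Phi>1 \<Phi>4 \<xi> \<beta> \<gamma> \<theta> v :: "real \<Rightarrow> real"
    and a b \<alpha>6 :: real
    and a1 a2 a3 a4 a5 a6 :: "real \<Rightarrow> real \<Rightarrow> real"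
    and M :: "real \<Rightarrow> real \<Rightarrow> real ^ 3 ^ 3"
  assumes "\<And>t. 0 \<le> t \<Longrightarrow> \<Phi>1 t \<noteq> 0"
    and "\<And>t. 0 \<le> t \<Longrightarrow> \<Phi>4 t \<noteq> 0"
    and "\<alpha>6 > 0"
    and "\<And>s t. 0 \<le> s \<Longrightarrow> s \<le> t \<Longrightarrow> a1 s t = \<Phi>1 t / \<Phi>1 s"
    and "\<And>s t. 0 \<le> s \<Longrightarrow> s \<le> t \<Longrightarrow> a4 s t = \<Phi>4 t / \<Phi>4 s"
    and "\<And>s t. 0 \<le> s \<Longrightarrow> s \<le> t \<Longrightarrow> a6 s t = (if t < \<alpha>6 then 1 else 0)"
    and "\<And>s t. 0 \<le> s \<Longrightarrow> s \<le> t \<Longrightarrow> a2 s t = \<Phi>4 t / \<Phi>1 s * (\<xi> t - \<xi> s)"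
    and "\<And>s t. 0 \<le> s \<Longrightarrow> s \<le> t \<Longrightarrow>
           a5 s t = 1 / \<Phi>4 s * (if t < \<alpha>6 then \<beta> t - \<beta> s else \<gamma> t)"
    and "\<And>s t. 0 \<le> s \<Longrightarrow> s \<le> t \<Longrightarrow>
           a3 s t = 1 / \<Phi>1 s *
             (if t < \<alpha>6
              then a * \<beta> s * \<xi> s - \<beta> t * \<xi> s + (1 - a) * \<beta> t * \<xi> t + \<theta> t - \<theta> s
              else \<gamma> t * (v t + b * \<xi> t - \<xi> s))"
    and "\<And>s t. 0 \<le> s \<Longrightarrow> s \<le> t \<Longrightarrow>
           M s t = vector [vector [a1 s t, a2 s t, a3 s t],
                           vector [0,      a4 s t, a5 s t],
                           vector [0,      0,      a6 s t]]"
  shows "generates_chain M"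
proof (rule generates_chainI)
  fix s \<tau> t :: real
  assume "0 \<le> s" "s < \<tau>" "\<tau> < t"
  then have le: "0 \<le> \<tau>" "0 \<le> t" "s \<le> \<tau>" "\<tau> \<le> t" "s \<le> t"
    by auto
  note nz = assms(1)[OF \<open>0 \<le> s\<close>] assms(1)[OF le(1)] assms(2)[OF \<open>0 \<le> s\<close>] assms(2)[OF le(1)]
  have "a1 s t = a1 s \<tau> * a1 \<tau> t"
    using nz le \<open>0 \<le> s\<close> by (simp add: assms(4))
  moreover have "a4 s t = a4 s \<tau> * a4 \<tau> t"
    using nz le \<open>0 \<le> s\<close> by (simp add: assms(5))
  \<comment> \<open>If t < \<alpha>6 then also \<tau> < \<alpha>6 and all three values are 1;
    otherwise both a6 s t and a6 \<tau> t vanish.\<close>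
  moreover have "a6 s t = a6 s \<tau> * a6 \<tau> t"
    using le \<open>0 \<le> s\<close> by (simp add: assms(6))
  moreover have "a2 s t = a1 s \<tau> * a2 \<tau> t + a2 s \<tau> * a4 \<tau> t"
  proof -
    \<comment> \<open>The increment of \<xi> is split at \<tau>; each summand is one of the two
      products after cancelling \<Phi>1 \<tau> or \<Phi>4 \<tau>.\<close>
    have "a2 s t = \<Phi>4 t * (\<xi> t - \<xi> \<tau>) / \<Phi>1 s + \<Phi>4 t * (\<xi> \<tau> - \<xi> s) / \<Phi>1 s"
      using le \<open>0 \<le> s\<close> by (simp add: assms(7) algebra_simps flip: add_divide_distrib diff_divide_distrib)
    also have "\<dots> = a1 s \<tau> * a2 \<tau> t + a2 s \<tau> * a4 \<tau> t"
      using nz le \<open>0 \<le> s\<close> by (simp add: assms(4,5,7))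
    finally show ?thesis .
  qed
  \<comment> \<open>Before \<alpha>6 the increments of \<beta> telescope. For t \<ge> \<alpha>6 the
    factor a6 \<tau> t = 0 removes a5 s \<tau>, whichever branch \<tau> lies in.\<close>
  moreover have "a5 s t = a4 s \<tau> * a5 \<tau> t + a5 s \<tau> * a6 \<tau> t"
    using nz le \<open>0 \<le> s\<close> by (simp add: assms(5,6,8) flip: add_divide_distrib)
  \<comment> \<open>Everything is put over \<Phi>1 s. For t < \<alpha>6 the product (\<xi> \<tau> -
    \<xi> s) * (\<beta> t - \<beta> \<tau>) from the middle term cancels the mixed terms, and the
    coefficients of \<beta> \<tau> * \<xi> \<tau> add up to a + (1 - a) - 1 = 0. For t \<ge>
    \<alpha>6 the last term vanishes, and the middle one replaces \<xi> \<tau> by \<xi> s inside the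
    factor of \<gamma> t.\<close>
  moreover have "a3 s t = a1 s \<tau> * a3 \<tau> t + a2 s \<tau> * a5 \<tau> t + a3 s \<tau> * a6 \<tau> t"
    using nz le \<open>0 \<le> s\<close>
    by (simp add: assms(4,6-9) flip: add_divide_distrib) (simp add: algebra_simps)
  ultimately show "M s t = M s \<tau> ** M \<tau> t"
    using le \<open>0 \<le> s\<close> by (simp add: assms(10) upper_triangular_3_mult)
qed

end
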